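(* Let $y\ge1$ be an integer, let $k\ge0$ be the integer with $2^k\le y<2^{k+1}$, and let $\ell>k$ be an integer. Define labelings $L,S:B_k\to\{0,1,2\}$ by $$L(x,z):=\text{c-Ulam}[y](x,2^k+z)=\text{c-Ulam}[y](2^k+x,z)$$ (the two expressions agree) and $$S(x,z):=\text{c-Ulam}[y](2^k+x,2^k+z).$$ Then $$\text{c-Ulam}[2^\ell+y]\big|_{B_{\ell+1}}=\Bigl(\text{c-Ulam}[2^{\ell-k}]\big|_{B_{\ell-k+1}}\,\widehat{\otimes}\,S\Bigr)\,\widehat{+}\,\Bigl(\text{c-Ulam}[2^{\ell-k}+1]\big|_{B_{\ell-k+1}}\,\widehat{\otimes}\,L\Bigr).$$
   Context: $\mathbb{N}=\{0,1,2,\dots\}$; $n\bmod m$ denotes the residue of $n$ in $\{0,\dots,m-1\}$. Ulam words are binary words defined recursively: $\mathcal{U}(1)=\{0,1\}$, and for $n>1$, $\mathcal{U}(n)$ is the set of all words of length $n$ over $\{0,1\}$ that are expressible uniquely as a concatenation $uv$ of two distinct words $u\in\mathcal{U}(i)$, $v\in\mathcal{U}(j)$ with $i,j<n$ (i.e. there is exactly one ordered pair $(u,v)$ of such words, $u\ne v$). A word is Ulam if it belongs to $\bigcup_{n\ge1}\mathcal{U}(n)$. $0^m$ denotes a block of $m$ zeros. The labeling $\text{c-Ulam}[y]:\mathbb{N}^2\to\{0,1,2\}$ is defined by letting $\text{c-Ulam}[y](x,z)$ be the minimum of $2$ and the number of representations of $0^x10^y10^z$ as a concatenation of two (not necessarily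 distinct) Ulam words with exactly one $1$ each, i.e. the number of integers $a$, $0\le a\le y$, such that both $0^x10^a$ and $0^{y-a}10^z$ are Ulam. $B_d=\{0,1,\dots,2^d-1\}^2$. For $m,n\in\{0,1,2\}$: $m\,\widehat{+}\,n=\min(m+n,2)$ and $m\,\widehat{\cdot}\,n=\min(mn,2)$; $\widehat{+}$ is applied pointwise to labelings. For $M:B_m\to\{0,1,2\}$ and $N:B_k\to\{0,1,2\}$, $M\,\widehat{\otimes}\,N:B_{m+k}\to\{0,1,2\}$ is $(M\,\widehat{\otimes}\,N)(x,z)=M(\lfloor x/2^k\rfloor,\lfloor z/2^k\rfloor)\,\widehat{\cdot}\,N(x\bmod 2^k,z\bmod 2^k)$. *)

theory Defs
  imports Main "HOL-Library.FuncSet"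
begin

text \<open>Binary words are lists of booleans, the letter 1 being \<^const>\<open>True\<close> and 0 being \<^const>\<open>False\<close>.\<close>

function Ulam :: "nat \<Rightarrow> bool list set" where
  "Ulam n =
    (if n = 0 then {}
     else if n = 1 then {[False], [True]}
     else {w. length w = n \<and>
            (\<exists>!p. w = fst p @ snd p \<and> fst p \<noteq> snd p \<and>
               (\<exists>i\<in>{1..<n}. fst p \<in> Ulam i) \<and> (\<exists>j\<in>{1..<n}. snd p \<in> Ulam j))})"
  by auto
termination
  by (relation "measure id") auto

declare Ulam.simps [simp del]

definition is_ulam :: "bool list \<Rightarrow> bool" where
  "is_ulam w \<longleftrightarrow> w \<in> (\<Union>n\<in>{1..}. Ulam n)"

definition zeros :: "nat \<Rightarrow> bool list" where
  "zeros m = replicate m False"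

definition c_ulam :: "nat \<Rightarrow> nat \<times> nat \<Rightarrow> nat" where
  "c_ulam y = (\<lambda>(x, z). min 2 (card {(u, v).
      u @ v = zeros x @ [True] @ zeros y @ [True] @ zeros z \<and>
      is_ulam u \<and> is_ulam v \<and> count_list u True = 1 \<and> count_list v True = 1}))"

lemma count_list_zeros [simp]: "count_list (zeros m) True = 0"
  by (induction m) (auto simp: zeros_def)

lemma zeros_add: "zeros (a + b) = zeros a @ zeros b"
  by (simp add: zeros_def replicate_add)

lemma length_zeros [simp]: "length (zeros m) = m"
  by (simp add: zeros_def)

lemma one_True_eq:
  assumes "count_list u True = 1"
  obtains a b where "u = zeros a @ [True] @ zeros b"
proof -
  have "True \<in> set u"
    using assms by (metis count_notin zero_neq_one)
  then obtain p q where u: "u = p @ True # q"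
    by (meson split_list)
  have "True \<notin> set p" "True \<notin> set q"
    using assms unfolding u by (auto simp: count_list_0_iff)
  then have "p = zeros (length p)" "q = zeros (length q)"
    unfolding zeros_def by (metis (full_types) replicate_eqI)+
  then show thesis
    using that[of "length p" "length q"] u by simp
qed

lemma zeros_True_eq:
  "zeros a @ True # s = zeros b @ True # t \<longleftrightarrow> a = b \<and> s = t"
proof (induction a arbitrary: b)
  case 0
  show ?case by (cases b) (auto simp: zeros_def)
next
  case (Suc a)
  then show ?case by (cases b) (auto simp: zeros_def)
qed

lemma c_ulam_eq_card_splits:
  "c_ulam y (x, z) = min 2 (card {a. a \<le> y \<and>
     is_ulam (zeros x @ [True] @ zeros a) \<and> is_ulam (zeros (y - a) @ [True] @ zeros z)})"
proof -
  let ?f = "\<lambda>a. (zeros x @ [True] @ zeros a, zeros (y - a) @ [True] @ zeros z)"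
  let ?A = "{a. a \<le> y \<and>
     is_ulam (zeros x @ [True] @ zeros a) \<and> is_ulam (zeros (y - a) @ [True] @ zeros z)}"
  let ?R = "{(u, v).
      u @ v = zeros x @ [True] @ zeros y @ [True] @ zeros z \<and>
      is_ulam u \<and> is_ulam v \<and> count_list u True = 1 \<and> count_list v True = 1}"
  have "?R \<subseteq> ?f ` ?A"
  proof clarify
    fix u v
    assume eq: "u @ v = zeros x @ [True] @ zeros y @ [True] @ zeros z"
      and U: "is_ulam u" "is_ulam v" and c: "count_list u True = 1" "count_list v True = 1"
    obtain a b where u: "u = zeros a @ [True] @ zeros b" using one_True_eq c(1) .
    obtain c d where v: "v = zeros c @ [True] @ zeros d" using one_True_eq c(2) .
    have "zeros a @ True # (zeros (b + c) @ True # zeros d)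
        = zeros x @ True # (zeros y @ True # zeros z)"
      using eq by (simp add: u v zeros_add)
    then have "a = x" "b + c = y" "zeros d = zeros z"
      unfolding zeros_True_eq by auto
    then have "a = x" "b \<le> y" "c = y - b" "d = z"
      by (auto dest: arg_cong[of _ _ length])
    then show "(u, v) \<in> ?f ` ?A"
      using U u v by (intro image_eqI[of _ _ b]) auto
  qed
  moreover have "?f ` ?A \<subseteq> ?R"
    by (auto simp flip: zeros_add)
  ultimately have "?R = ?f ` ?A" by blast
  moreover have "inj_on ?f ?A"
    by (auto simp: inj_on_def dest: arg_cong[of _ _ length])
  ultimately show ?thesis
    unfolding c_ulam_def by (simp add: card_image)
qed

definition B :: "nat \<Rightarrow> (nat \<times> nat) set" where
  "B d = {0..2 ^ d - 1} \<times> {0..2 ^ d - 1}"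

definition sat_add :: "nat \<Rightarrow> nat \<Rightarrow> nat" where
  "sat_add m n = min (m + n) 2"

definition sat_mult :: "nat \<Rightarrow> nat \<Rightarrow> nat" where
  "sat_mult m n = min (m * n) 2"

text \<open>A labeling of \<^term>\<open>B d\<close> is a function extended by \<^const>\<open>undefined\<close> outside
  \<^term>\<open>B d\<close>, as produced by \<^const>\<open>restrict\<close>. The exponents of the
  domains are passed explicitly.\<close>

definition lab_add ::
  "nat \<Rightarrow> (nat \<times> nat \<Rightarrow> nat) \<Rightarrow> (nat \<times> nat \<Rightarrow> nat) \<Rightarrow> nat \<times> nat \<Rightarrow> nat" where
  "lab_add d M N = restrict (\<lambda>p. sat_add (M p) (N p)) (B d)"

definition lab_tensor ::
  "nat \<Rightarrow> nat \<Rightarrow> (nat \<times> nat \<Rightarrow> nat) \<Rightarrow> (nat \<times> nat \<Rightarrow> nat) \<Rightarrow> nat \<times> nat \<Rightarrow> nat" where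
  "lab_tensor m k M N = restrict (\<lambda>(x, z).
     sat_mult (M (x div 2 ^ k, z div 2 ^ k)) (N (x mod 2 ^ k, z mod 2 ^ k))) (B (m + k))"

end

theory Submission
  imports Defs
begin

text \<open>The word \<open>0\<^sup>x10\<^sup>z\<close> is Ulam iff the binary supports of \<open>x\<close> and \<open>z\<close> are disjoint, since
  splitting off a letter 0 on either side gives Pascal's recursion modulo 2. Hence
  \<open>c-Ulam[y](x,z)\<close> is the truncated number of sums \<open>a + b = y\<close> with \<open>a\<close> disjoint from \<open>x\<close>
  and \<open>b\<close> disjoint from \<open>z\<close>. Cutting \<open>a\<close> and \<open>b\<close> at bit \<open>k\<close> and distinguishing whether the low
  parts produce a carry gives the exact count for \<open>2\<^sup>\<ell> + y\<close> as \<open>N\<^sub>0P + N\<^sub>1Q\<close>, where \<open>N\<^sub>0, N\<^sub>1\<close>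
  are the counts for \<open>2\<^bsup>\<ell>-k\<^esup>\<close> and \<open>2\<^bsup>\<ell>-k\<^esup> + 1\<close>, and \<open>P, Q\<close> are the counts of low parts with and without
  carry. The same splitting of \<open>y\<close> itself gives \<open>S = P\<close> and \<open>L = P + Q\<close> up to truncation, so the claim is that
  the surplus \<open>N\<^sub>1P\<close> is invisible after truncation at 2. This holds because \<open>P > 0\<close> implies \<open>Q > 0\<close> (erase the
  bits that cause the carry) and \<open>N\<^sub>1 > 0\<close> implies \<open>N\<^sub>0 > 0\<close> (erase the lowest bit).\<close>

section \<open>Ulam words with at most one letter 1\<close>

lemma length_Ulam: "w \<in> Ulam n \<Longrightarrow> length w = n \<and> 1 \<le> n"
  by (subst (asm) Ulam.simps) (auto split: if_splits)

lemma is_ulam_iff: "is_ulam w \<longleftrightarrow> w \<in> Ulam (length w)"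
  unfolding is_ulam_def using length_Ulam by auto

lemma not_is_ulam_Nil [simp]: "\<not> is_ulam []"
  using length_Ulam by (fastforce simp: is_ulam_iff)

lemma is_ulam_single [simp]: "is_ulam [b]"
  by (cases b) (simp_all add: is_ulam_iff Ulam.simps)

text \<open>Ulam words are nonempty, so both factors are shorter than \<open>w\<close> and the
  length bounds in \<open>Ulam\<close> hold automatically.\<close>

lemma is_ulam_rec:
  assumes "2 \<le> length w"
  shows "is_ulam w \<longleftrightarrow>
    (\<exists>!p. w = fst p @ snd p \<and> fst p \<noteq> snd p \<and> is_ulam (fst p) \<and> is_ulam (snd p))"
proof -
  let ?n = "length w"
  have part: "(\<exists>i\<in>{1..<?n}. u \<in> Ulam i) \<longleftrightarrow> is_ulam u \<and> length u < ?n" for u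
    using length_Ulam unfolding is_ulam_iff by (metis atLeastLessThan_iff)
  have pos: "is_ulam u \<Longrightarrow> 0 < length u" for u
    by (cases u) auto
  have "w = fst p @ snd p \<and> fst p \<noteq> snd p \<and>
        (\<exists>i\<in>{1..<?n}. fst p \<in> Ulam i) \<and> (\<exists>j\<in>{1..<?n}. snd p \<in> Ulam j) \<longleftrightarrow>
      w = fst p @ snd p \<and> fst p \<noteq> snd p \<and> is_ulam (fst p) \<and> is_ulam (snd p)" for p
    unfolding part using pos by (metis add_less_cancel_left add.commute add.right_neutral length_append)
  moreover have "length w \<noteq> 1" "w \<noteq> []" using assms by auto
  ultimately show ?thesis
    unfolding is_ulam_iff[of w] by (subst Ulam.simps) simp
qed

lemma append_eq_zeros_iff:
  "u @ v = zeros n \<longleftrightarrow> (\<exists>i j. i + j = n \<and> u = zeros i \<and> v = zeros j)"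
proof
  assume eq: "u @ v = zeros n"
  then have "\<forall>b\<in>set u \<union> set v. \<not> b"
    unfolding zeros_def by (metis in_set_replicate set_append)
  then have "u = zeros (length u)" "v = zeros (length v)"
    unfolding zeros_def by (auto intro!: replicate_eqI)
  moreover have "length u + length v = n"
    using arg_cong[OF eq, of length] by simp
  ultimately show "\<exists>i j. i + j = n \<and> u = zeros i \<and> v = zeros j" by blast
qed (auto simp: zeros_add)

text \<open>For \<open>m \<ge> 2\<close> induction leaves only the letter 0 for both factors, and
  these are not distinct.\<close>

lemma is_ulam_zeros_iff: "is_ulam (zeros m) \<longleftrightarrow> m = 1"
proof (induction m rule: less_induct)
  case (less m)
  consider "m = 0" | "m = 1" | "2 \<le> m" by linarith
  then show ?case
  proof cases
    case 3
    have False if uv: "zeros m = u @ v" "u \<noteq> v" "is_ulam u" "is_ulam v" for u v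
    proof -
      obtain i j where ij: "i + j = m" "u = zeros i" "v = zeros j"
        using iffD1[OF append_eq_zeros_iff uv(1)[symmetric]] by blast
      have "i \<noteq> 0" "j \<noteq> 0"
        using that ij by (auto simp: zeros_def intro!: Nat.gr0I)
      then show False
        using less.IH[of i] less.IH[of j] ij that by auto
    qed
    then have "\<not> is_ulam (zeros m)"
      using is_ulam_rec[of "zeros m"] 3 by (metis length_zeros)
    then show ?thesis using 3 by simp
  qed (simp_all add: zeros_def)
qed

abbreviation single_one :: "nat \<Rightarrow> nat \<Rightarrow> bool list" where
  "single_one x z \<equiv> zeros x @ [True] @ zeros z"

lemma append_eq_single_one_iff:
  "u @ v = single_one x z \<longleftrightarrow>
    (\<exists>i j. i + j = x \<and> u = zeros i \<and> v = single_one j z) \<or>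
    (\<exists>i j. i + j = z \<and> u = single_one x i \<and> v = zeros j)"
proof
  assume "u @ v = single_one x z"
  then consider (left) us where "u = zeros x @ us" "us @ v = True # zeros z"
    | (right) us where "u @ us = zeros x" "v = us @ True # zeros z"
    by (auto simp: append_eq_append_conv2)
  then show "(\<exists>i j. i + j = x \<and> u = zeros i \<and> v = single_one j z) \<or>
    (\<exists>i j. i + j = z \<and> u = single_one x i \<and> v = zeros j)"
  proof cases
    case left
    show ?thesis
    proof (cases us)
      case Nil
      then show ?thesis using left by (intro disjI1 exI[of _ x] exI[of _ 0]) (simp add: zeros_def)
    next
      case (Cons b us')
      then have "us' @ v = zeros z" "b" using left by auto
      then show ?thesis using left Cons by (auto simp: append_eq_zeros_iff)
    qed
  next
    case right
    then show ?thesis by (auto simp: append_eq_zeros_iff)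
  qed
qed (auto simp: zeros_add)

text \<open>One of the two factors contains no 1, so it is the single letter 0, removed on the left
  or on the right. Unique expressibility is the exclusive or of these two options.\<close>

lemma is_ulam_single_one_rec:
  assumes "x + z \<ge> 1"
  shows "is_ulam (single_one x z) \<longleftrightarrow>
    (x \<ge> 1 \<and> is_ulam (single_one (x - 1) z)) \<noteq> (z \<ge> 1 \<and> is_ulam (single_one x (z - 1)))"
    (is "_ \<longleftrightarrow> ?P \<noteq> ?Q")
proof -
  let ?p = "(zeros 1, single_one (x - 1) z)" and ?q = "(single_one x (z - 1), zeros 1)"
  have ne: "zeros i \<noteq> single_one a b" for i a b
    by (metis append_Cons append_Nil in_set_conv_decomp in_set_replicate zeros_def)
  have decomp: "(single_one x z = u @ v \<and> u \<noteq> v \<and> is_ulam u \<and> is_ulam v) \<longleftrightarrow>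
      ?P \<and> (u, v) = ?p \<or> ?Q \<and> (u, v) = ?q" for u v
  proof -
    have "(\<exists>i j. i + j = x \<and> u = zeros i \<and> v = single_one j z) \<and>
        u \<noteq> v \<and> is_ulam u \<and> is_ulam v \<longleftrightarrow> ?P \<and> (u, v) = ?p"
    proof
      assume "(\<exists>i j. i + j = x \<and> u = zeros i \<and> v = single_one j z) \<and>
        u \<noteq> v \<and> is_ulam u \<and> is_ulam v"
      then obtain i j where "i + j = x" "u = zeros i" "v = single_one j z" "is_ulam u" "is_ulam v"
        by blast
      moreover from this have "i = 1" "j = x - 1" by (auto simp: is_ulam_zeros_iff)
      ultimately show "?P \<and> (u, v) = ?p" by simp
    next
      assume "?P \<and> (u, v) = ?p"
      then show "(\<exists>i j. i + j = x \<and> u = zeros i \<and> v = single_one j z) \<and>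
        u \<noteq> v \<and> is_ulam u \<and> is_ulam v"
        using ne by (intro conjI exI[of _ 1] exI[of _ "x - 1"]) (auto simp: is_ulam_zeros_iff)
    qed
    moreover have "(\<exists>i j. i + j = z \<and> u = single_one x i \<and> v = zeros j) \<and>
        u \<noteq> v \<and> is_ulam u \<and> is_ulam v \<longleftrightarrow> ?Q \<and> (u, v) = ?q"
    proof
      assume "(\<exists>i j. i + j = z \<and> u = single_one x i \<and> v = zeros j) \<and>
        u \<noteq> v \<and> is_ulam u \<and> is_ulam v"
      then obtain i j where "i + j = z" "u = single_one x i" "v = zeros j" "is_ulam u" "is_ulam v"
        by blast
      moreover from this have "j = 1" "i = z - 1" by (auto simp: is_ulam_zeros_iff)
      ultimately show "?Q \<and> (u, v) = ?q" by simp
    next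
      assume "?Q \<and> (u, v) = ?q"
      then show "(\<exists>i j. i + j = z \<and> u = single_one x i \<and> v = zeros j) \<and>
        u \<noteq> v \<and> is_ulam u \<and> is_ulam v"
        using ne[symmetric]
        by (intro conjI exI[of _ 1] exI[of _ "z - 1"]) (auto simp: is_ulam_zeros_iff)
    qed
    moreover have "single_one x z = u @ v \<longleftrightarrow> u @ v = single_one x z" by auto
    ultimately show ?thesis
      unfolding append_eq_single_one_iff by blast
  qed
  have "is_ulam (single_one x z) \<longleftrightarrow> (\<exists>!p. ?P \<and> p = ?p \<or> ?Q \<and> p = ?q)"
    using is_ulam_rec[of "single_one x z"] assms
    unfolding decomp prod.collapse by simp
  moreover have "?p \<noteq> ?q" using ne by auto
  ultimately show ?thesis by metis
qed

section \<open>Disjoint binary supports and Pascal's triangle modulo 2\<close>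

lemma and_nat_eq_0_rec:
  "and m n = 0 \<longleftrightarrow> \<not> (odd m \<and> odd n) \<and> and (m div 2) (n div 2) = 0" for m n :: nat
proof -
  have "and m n = of_bool (odd m \<and> odd n) + 2 * and (m div 2) (n div 2)"
    by (rule and_rec)
  then show ?thesis by simp
qed

lemma and_double_eq_0:
  fixes m n :: nat
  shows "and (2 * m) (2 * n) = 0 \<longleftrightarrow> and m n = 0"
    and "and (Suc (2 * m)) (2 * n) = 0 \<longleftrightarrow> and m n = 0"
    and "and (2 * m) (Suc (2 * n)) = 0 \<longleftrightarrow> and m n = 0"
    and "and (Suc (2 * m)) (Suc (2 * n)) \<noteq> 0"
  using and_nat_eq_0_rec[of "2 * m" "2 * n"] and_nat_eq_0_rec[of "Suc (2 * m)" "2 * n"]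
    and_nat_eq_0_rec[of "2 * m" "Suc (2 * n)"] and_nat_eq_0_rec[of "Suc (2 * m)" "Suc (2 * n)"]
  by simp_all

lemma Suc_Suc_double: "Suc (Suc (2 * n)) = 2 * Suc n"
  by simp

text \<open>Pascal's rule modulo 2, as disjoint supports mean that the binomial coefficient of
  \<open>x + z\<close> over \<open>x\<close> is odd. Halving decides every parity case at once,
  except \<open>x\<close> and \<open>z\<close> both odd, which descends to the induction
  hypothesis.\<close>

lemma and_eq_0_pascal:
  fixes x z :: nat
  shows "and (Suc x) (Suc z) = 0 \<longleftrightarrow> (and x (Suc z) = 0) \<noteq> (and (Suc x) z = 0)"
proof (induction x arbitrary: z rule: less_induct)
  case (less x)
  obtain m n where "x = 2 * m \<or> x = Suc (2 * m)" "z = 2 * n \<or> z = Suc (2 * n)"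
    by (metis evenE oddE Suc_eq_plus1)
  then consider "x = 2 * m" "z = 2 * n" | "x = 2 * m" "z = Suc (2 * n)"
    | "x = Suc (2 * m)" "z = 2 * n" | "x = Suc (2 * m)" "z = Suc (2 * n)"
    by blast
  then show ?case
  proof cases
    case 1
    then show ?thesis
      by (simp only: and_double_eq_0 simp_thms)
  next
    case 2
    then show ?thesis
      by (simp only: and_double_eq_0 simp_thms Suc_Suc_double)
  next
    case 3
    then show ?thesis
      by (simp only: and_double_eq_0 simp_thms Suc_Suc_double)
  next
    case 4
    then have "m < x" by simp
    then show ?thesis
      using less.IH[of m n] 4
      by (simp only: and_double_eq_0 simp_thms Suc_Suc_double)
  qed
qed

lemma is_ulam_single_one_iff: "is_ulam (single_one x z) \<longleftrightarrow> and x z = 0"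
proof (induction "x + z" arbitrary: x z rule: less_induct)
  case less
  show ?case
  proof (cases "x + z \<ge> 1")
    case True
    have "x \<ge> 1 \<Longrightarrow> is_ulam (single_one (x - 1) z) \<longleftrightarrow> and (x - 1) z = 0"
      "z \<ge> 1 \<Longrightarrow> is_ulam (single_one x (z - 1)) \<longleftrightarrow> and x (z - 1) = 0"
      using less by auto
    \<comment> \<open>Pascal's rule covers positive \<open>x\<close> and \<open>z\<close>. If one of
      them is 0, a letter can be split off on one side only and the Ulam property is
      inherited.\<close>
    then show ?thesis
      using is_ulam_single_one_rec[OF True] and_eq_0_pascal[of "x - 1" "z - 1"] True
      by (cases "x = 0"; cases "z = 0") auto
  next
    case False
    then have "x = 0" "z = 0" by auto
    then show ?thesis by (simp add: zeros_def)
  qed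
qed

section \<open>Counting sums with disjoint supports\<close>

text \<open>Ordered pairs instead of \<open>a\<close> alone avoid the subtraction
  \<open>y - a\<close> and let both summands be cut in the same way.\<close>

definition reps :: "nat \<Rightarrow> nat \<Rightarrow> nat \<Rightarrow> (nat \<times> nat) set" where
  "reps s x z = {(a, b). a + b = s \<and> and x a = 0 \<and> and b z = 0}"

lemma c_ulam_eq_card_reps: "c_ulam y (x, z) = min 2 (card (reps y x z))"
proof -
  let ?A = "{a. a \<le> y \<and> and x a = 0 \<and> and (y - a) z = 0}"
  have "bij_betw (\<lambda>a. (a, y - a)) ?A (reps y x z)"
    by (rule bij_betwI[where g = fst]) (auto simp: reps_def)
  then show ?thesis
    unfolding c_ulam_eq_card_splits is_ulam_single_one_iff by (simp add: bij_betw_same_card)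
qed

lemma finite_reps [simp]: "finite (reps s x z)"
  by (rule finite_subset[of _ "{..s} \<times> {..s}"]) (auto simp: reps_def)

text \<open>For \<open>s \<ge> 2 ^ k\<close> these are the low parts whose sum carries into bit
  \<open>k\<close>.\<close>

definition low_reps :: "nat \<Rightarrow> nat \<Rightarrow> nat \<Rightarrow> nat \<Rightarrow> (nat \<times> nat) set" where
  "low_reps k s x z = reps s x z \<inter> {..<2 ^ k} \<times> {..<2 ^ k}"

lemma and_eq_0_split:
  "and m n = 0 \<longleftrightarrow>
    and (m div 2 ^ k) (n div 2 ^ k) = 0 \<and> and (m mod 2 ^ k) (n mod 2 ^ k) = 0" for m n :: nat
proof -
  have "and m n = 0 \<longleftrightarrow> drop_bit k (and m n) = 0 \<and> take_bit k (and m n) = 0"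
    by (metis bits_ident add_0 push_bit_of_0 drop_bit_of_0 take_bit_of_0)
  then show ?thesis
    by (simp flip: drop_bit_eq_div take_bit_eq_mod)
qed

text \<open>The difference \<open>c + d - y\<close>, taken in the integers, is a multiple of
  \<open>2 ^ k\<close> strictly between \<open>-2 ^ (k + 1)\<close> and \<open>2 ^ k\<close>, hence
  0 or \<open>-2 ^ k\<close>.\<close>

lemma low_high_sum_cases:
  fixes a b c d k n y :: nat
  assumes "2 ^ k \<le> y" "y < 2 ^ (k + 1)" "c < 2 ^ k" "d < 2 ^ k"
  shows "2 ^ k * a + c + (2 ^ k * b + d) = 2 ^ k * n + y \<longleftrightarrow>
    a + b = n \<and> c + d = y \<or> a + b = n + 1 \<and> c + d = y - 2 ^ k"
proof -
  have *: "2 ^ k * (a + b) + (c + d) = 2 ^ k * n + y \<longleftrightarrow>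
    a + b = n \<and> c + d = y \<or> a + b = n + 1 \<and> c + d = y - 2 ^ k"
  proof
    assume eq: "2 ^ k * (a + b) + (c + d) = 2 ^ k * n + y"
    consider "a + b < n" | "a + b = n" | "a + b = n + 1" | "a + b \<ge> n + 2" by linarith
    then show "a + b = n \<and> c + d = y \<or> a + b = n + 1 \<and> c + d = y - 2 ^ k"
    proof cases
      case 1
      then have "2 ^ k * (a + b + 1) \<le> 2 ^ k * n" by (intro mult_left_mono) auto
      then show ?thesis using eq assms by (simp add: algebra_simps)
    next
      case 4
      then have "2 ^ k * (n + 2) \<le> 2 ^ k * (a + b)" by (intro mult_left_mono) auto
      then show ?thesis using eq assms by (simp add: algebra_simps)
    qed (use eq assms in \<open>auto simp: algebra_simps\<close>)
  qed (use assms in auto)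
  have "2 ^ k * a + c + (2 ^ k * b + d) = 2 ^ k * (a + b) + (c + d)"
    by (simp add: algebra_simps)
  then show ?thesis using * by (simp only:)
qed

text \<open>Division by \<open>2 ^ k\<close> cuts both summands. Bit \<open>k\<close> of
  \<open>y\<close> is either produced by a carry, leaving \<open>n\<close> to the high parts, or
  supplied by the high parts, which then add up to \<open>n + 1\<close>.\<close>

lemma card_reps_split:
  assumes y: "2 ^ k \<le> y" "y < 2 ^ (k + 1)"
  shows "card (reps (2 ^ k * n + y) x z) =
    card (reps n (x div 2 ^ k) (z div 2 ^ k)) * card (low_reps k y (x mod 2 ^ k) (z mod 2 ^ k)) +
    card (reps (n + 1) (x div 2 ^ k) (z div 2 ^ k)) *
      card (low_reps k (y - 2 ^ k) (x mod 2 ^ k) (z mod 2 ^ k))"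
    (is "_ = card ?R0 * card ?P + card ?R1 * card ?Q")
proof -
  let ?f = "\<lambda>((A :: nat, B :: nat), (a, b)). (2 ^ k * A + a, 2 ^ k * B + b)"
  let ?g = "\<lambda>(a :: nat, b :: nat).
    ((a div 2 ^ k, b div 2 ^ k), (a mod 2 ^ k, b mod 2 ^ k))"
  have "bij_betw ?f (?R0 \<times> ?P \<union> ?R1 \<times> ?Q) (reps (2 ^ k * n + y) x z)"
  proof (rule bij_betwI[where g = ?g])
    show "?f \<in> ?R0 \<times> ?P \<union> ?R1 \<times> ?Q \<rightarrow> reps (2 ^ k * n + y) x z"
    proof (rule Pi_I)
      fix p assume p: "p \<in> ?R0 \<times> ?P \<union> ?R1 \<times> ?Q"
      obtain A B a b where [simp]: "p = ((A, B), (a, b))" by (metis surj_pair)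
      have "a < 2 ^ k" "b < 2 ^ k" using p by (auto simp: low_reps_def)
      then show "?f p \<in> reps (2 ^ k * n + y) x z"
        using p low_high_sum_cases[OF y, of a b A B n]
          and_eq_0_split[of x "2 ^ k * A + a" k] and_eq_0_split[of "2 ^ k * B + b" z k]
        by (auto simp: reps_def low_reps_def)
    qed
    show "?g \<in> reps (2 ^ k * n + y) x z \<rightarrow> ?R0 \<times> ?P \<union> ?R1 \<times> ?Q"
    proof (rule Pi_I)
      fix p assume p: "p \<in> reps (2 ^ k * n + y) x z"
      obtain a b where [simp]: "p = (a, b)" by (metis surj_pair)
      have "2 ^ k * (a div 2 ^ k) + a mod 2 ^ k + (2 ^ k * (b div 2 ^ k) + b mod 2 ^ k)
          = 2 ^ k * n + y"
        using p by (simp add: reps_def)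
      then show "?g p \<in> ?R0 \<times> ?P \<union> ?R1 \<times> ?Q"
        using p low_high_sum_cases[OF y, of "a mod 2 ^ k" "b mod 2 ^ k" "a div 2 ^ k" "b div 2 ^ k" n]
          and_eq_0_split[of x a k] and_eq_0_split[of b z k]
        by (auto simp: reps_def low_reps_def)
    qed
  qed (auto simp: low_reps_def)
  \<comment> \<open>The union is disjoint because the high parts have different sums.\<close>
  moreover have "card (?R0 \<times> ?P \<union> ?R1 \<times> ?Q) = card ?R0 * card ?P + card ?R1 * card ?Q"
    by (subst card_Un_disjoint) (auto simp: low_reps_def card_cartesian_product, auto simp: reps_def)
  ultimately show ?thesis
    using bij_betw_same_card by metis
qed

section \<open>Erasing bits to reach smaller sums\<close>

lemma and_mod_eq_0: "and m n = 0 \<Longrightarrow> and m (n mod 2 ^ k) = 0" for m n :: nat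
proof -
  assume "and m n = 0"
  moreover have "and m (n mod 2 ^ k) = and (and m n) (mask k)"
    by (simp add: take_bit_eq_mask and.assoc flip: take_bit_eq_mod)
  ultimately show ?thesis by simp
qed

text \<open>Erasing bits preserves disjointness. If both summands contain the top bit, erasing it in
  both lowers the sum by the required power; otherwise the carry comes from lower bits.\<close>

lemma erase_carry:
  fixes a b x z :: nat
  assumes "a < 2 ^ k" "b < 2 ^ k" "2 ^ k \<le> a + b" "and x a = 0" "and b z = 0"
  shows "\<exists>a' b'. a' + b' + 2 ^ k = a + b \<and> and x a' = 0 \<and> and b' z = 0"
  using assms
proof (induction k arbitrary: a b)
  case (Suc k)
  define a1 b1 where "a1 = a mod 2 ^ k" and "b1 = b mod 2 ^ k"
  have sub: "and x a1 = 0" "and b1 z = 0"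
    using Suc.prems and_mod_eq_0[of x a k] and_mod_eq_0[of z b k]
    by (simp_all only: a1_def b1_def and.commute[of _ z])
  have lt: "a1 < 2 ^ k" "b1 < 2 ^ k" by (auto simp: a1_def b1_def)
  have "a div 2 ^ k < 2" "b div 2 ^ k < 2"
    using Suc.prems by (auto simp: less_mult_imp_div_less)
  then have split: "a = a1 \<or> a = 2 ^ k + a1" "b = b1 \<or> b = 2 ^ k + b1"
    using div_mult_mod_eq[of a "2 ^ k"] div_mult_mod_eq[of b "2 ^ k"]
    by (auto simp: a1_def b1_def less_2_cases_iff)
  show ?case
  proof (cases "a = 2 ^ k + a1 \<and> b = 2 ^ k + b1")
    case True
    then show ?thesis using sub by (intro exI[of _ a1] exI[of _ b1]) auto
  next
    case False
    \<comment> \<open>Without any top bit the sum would be too small, so exactly one summand has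
      it.\<close>
    then have eq: "a + b = 2 ^ k + (a1 + b1)"
      using split lt Suc.prems by auto
    then have "2 ^ k \<le> a1 + b1" using Suc.prems by simp
    then obtain a' b' where "a' + b' + 2 ^ k = a1 + b1" "and x a' = 0" "and b' z = 0"
      using Suc.IH[OF lt] sub by blast
    then show ?thesis
      using eq by (intro exI[of _ a'] exI[of _ b']) auto
  qed
qed simp

lemma low_reps_without_carry_nonempty:
  assumes "2 ^ k \<le> y" "y < 2 ^ (k + 1)" "low_reps k y x z \<noteq> {}"
  shows "low_reps k (y - 2 ^ k) x z \<noteq> {}"
proof -
  obtain a b where "a < 2 ^ k" "b < 2 ^ k" "a + b = y" "and x a = 0" "and b z = 0"
    using assms(3) by (auto simp: low_reps_def reps_def)
  then obtain a' b' where "a' + b' + 2 ^ k = y" "and x a' = 0" "and b' z = 0"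
    using erase_carry[of a k b x z] assms(1) by metis
  \<comment> \<open>Both are below \<open>2 ^ k\<close> because their sum is
    \<open>y - 2 ^ k\<close>.\<close>
  then have "(a', b') \<in> low_reps k (y - 2 ^ k) x z"
    using assms(2) by (auto simp: low_reps_def reps_def)
  then show ?thesis by blast
qed

text \<open>Since \<open>s + 1\<close> is odd, exactly one summand is odd, and its lowest bit can be
  erased.\<close>

lemma reps_even_nonempty:
  assumes "even s" "reps (s + 1) x z \<noteq> {}"
  shows "reps s x z \<noteq> {}"
proof -
  obtain a b where ab: "a + b = s + 1" "and x a = 0" "and b z = 0"
    using assms(2) by (auto simp: reps_def)
  have drop: "and m (n - 1) = 0" if "odd n" and 0: "and m n = 0" for m n :: nat
  proof -
    obtain q where n: "n = Suc (2 * q)" using \<open>odd n\<close> by (auto elim: oddE)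
    have "and (m div 2) q = 0" using 0 and_nat_eq_0_rec[of m n] n by simp
    then show ?thesis using and_nat_eq_0_rec[of m "2 * q"] n by simp
  qed
  have "odd (a + b)" using ab(1) assms(1) by simp
  then consider "odd a" | "odd b" by auto
  then show ?thesis
  proof cases
    case 1
    then have "(a - 1, b) \<in> reps s x z"
      using ab drop[of a x] odd_pos[of a] by (simp add: reps_def)
    then show ?thesis by blast
  next
    case 2
    then have "(a, b - 1) \<in> reps s x z"
      using ab drop[of b z] odd_pos[of b] by (simp add: reps_def and.commute)
    then show ?thesis by blast
  qed
qed

section \<open>The recursion\<close>

lemma reps_0: "reps 0 x z = {(0, 0)}"
  by (auto simp: reps_def)

lemma reps_1: "reps 1 x z =
    (if even x then {(1, 0)} else {}) \<union> (if even z then {(0, 1)} else {})"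
proof -
  have "and x 1 = 0 \<longleftrightarrow> even x" "and 1 z = 0 \<longleftrightarrow> even z"
    by (simp_all only: and_one_eq one_and_eq even_iff_mod_2_eq_zero)
  then have "(1, 0) \<in> reps 1 x z \<longleftrightarrow> even x" "(0, 1) \<in> reps 1 x z \<longleftrightarrow> even z"
    unfolding reps_def by simp_all
  moreover have "reps 1 x z \<subseteq> {(1, 0), (0, 1)}"
    unfolding reps_def by auto
  ultimately show ?thesis by (cases "even x"; cases "even z") auto
qed

text \<open>Cut \<open>y\<close> with \<open>n = 0\<close>. The high sum 0 has one representation.
  The high sum 1 has one if exactly one coordinate is shifted by \<open>2 ^ k\<close>, and none if
  both are.\<close>

lemma c_ulam_block:
  assumes y: "2 ^ k \<le> y" "y < 2 ^ (k + 1)" and x: "x < 2 ^ k" and z: "z < 2 ^ k"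
  defines "P \<equiv> card (low_reps k y x z)" and "Q \<equiv> card (low_reps k (y - 2 ^ k) x z)"
  shows "c_ulam y (x, 2 ^ k + z) = min 2 (P + Q)"
    and "c_ulam y (2 ^ k + x, z) = min 2 (P + Q)"
    and "c_ulam y (2 ^ k + x, 2 ^ k + z) = min 2 P"
proof -
  have divs: "x div 2 ^ k = 0" "z div 2 ^ k = 0" "(2 ^ k + x) div 2 ^ k = 1" "(2 ^ k + z) div 2 ^ k = 1"
    and mods: "x mod 2 ^ k = x" "z mod 2 ^ k = z"
      "(2 ^ k + x) mod 2 ^ k = x" "(2 ^ k + z) mod 2 ^ k = z"
    using x z by (simp_all add: div_add_self1)
  note split = card_reps_split[OF y, of 0, unfolded add_0 mult_0_right reps_0 reps_1]
  show "c_ulam y (x, 2 ^ k + z) = min 2 (P + Q)"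
    using split[of x "2 ^ k + z", unfolded divs mods] by (simp add: c_ulam_eq_card_reps P_def Q_def)
  show "c_ulam y (2 ^ k + x, z) = min 2 (P + Q)"
    using split[of "2 ^ k + x" z, unfolded divs mods] by (simp add: c_ulam_eq_card_reps P_def Q_def)
  show "c_ulam y (2 ^ k + x, 2 ^ k + z) = min 2 P"
    using split[of "2 ^ k + x" "2 ^ k + z", unfolded divs mods]
    by (simp add: c_ulam_eq_card_reps P_def)
qed

lemma sat_mult_truncated: "sat_mult (min 2 m) (min 2 n) = min 2 (m * n)"
proof -
  have "m = 0 \<or> m = 1 \<or> 2 \<le> m" "n = 0 \<or> n = 1 \<or> 2 \<le> n" by auto
  moreover have "2 \<le> m * n" if "2 \<le> m" "2 \<le> n"
    using mult_le_mono[OF that] by simp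
  ultimately show ?thesis by (auto simp: sat_mult_def min_def)
qed

lemma sat_add_truncated: "sat_add (min 2 m) (min 2 n) = min 2 (m + n)"
  by (auto simp: sat_add_def min_def)

text \<open>If the surplus \<open>N * P\<close> is positive, then so are \<open>M * P\<close> and
  \<open>N * Q\<close>, and both sides already reach 2.\<close>

lemma truncated_surplus:
  fixes M N P Q :: nat
  assumes "P > 0 \<Longrightarrow> Q > 0" "N > 0 \<Longrightarrow> M > 0"
  shows "min 2 (M * P + N * Q) = min 2 (M * P + N * (P + Q))"
proof (cases "P = 0 \<or> N = 0")
  case False
  then have "2 \<le> M * P + N * Q"
    using mult_le_mono[of 1 M 1 P] mult_le_mono[of 1 N 1 Q] assms by linarith
  moreover from this have "2 \<le> M * P + N * (P + Q)"
    by (simp add: distrib_left)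
  ultimately show ?thesis by simp
qed auto

theorem theorem1p12:
  fixes y k l :: nat and L S :: "nat \<times> nat \<Rightarrow> nat"
  assumes "y \<ge> 1" and "2 ^ k \<le> y" and "y < 2 ^ (k + 1)" and "l > k"
    and "L = restrict (\<lambda>(x, z). c_ulam y (x, 2 ^ k + z)) (B k)"
    and "S = restrict (\<lambda>(x, z). c_ulam y (2 ^ k + x, 2 ^ k + z)) (B k)"
  shows "L = restrict (\<lambda>(x, z). c_ulam y (2 ^ k + x, z)) (B k) \<and>
    restrict (c_ulam (2 ^ l + y)) (B (l + 1)) =
      lab_add (l + 1)
        (lab_tensor (l - k + 1) k (restrict (c_ulam (2 ^ (l - k))) (B (l - k + 1))) S)
        (lab_tensor (l - k + 1) k (restrict (c_ulam (2 ^ (l - k) + 1)) (B (l - k + 1))) L)"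
proof
  have B_iff: "(x, z) \<in> B d \<longleftrightarrow> x < 2 ^ d \<and> z < 2 ^ d" for x z d
    by (auto simp: B_def le_eq_less_or_eq Suc_le_eq simp flip: less_Suc_eq_le)
  show "L = restrict (\<lambda>(x, z). c_ulam y (2 ^ k + x, z)) (B k)"
    unfolding assms(5) using c_ulam_block[OF assms(2,3)]
    by (intro restrict_ext) (auto simp: B_iff)
  have exps: "l - k + 1 + k = l + 1" using assms(4) by simp
  have "c_ulam (2 ^ l + y) (x, z) =
      sat_add
        (sat_mult (c_ulam (2 ^ (l - k)) (x div 2 ^ k, z div 2 ^ k)) (S (x mod 2 ^ k, z mod 2 ^ k)))
        (sat_mult (c_ulam (2 ^ (l - k) + 1) (x div 2 ^ k, z div 2 ^ k))
          (L (x mod 2 ^ k, z mod 2 ^ k)))" for x z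
  proof -
    define M where "M = card (reps (2 ^ (l - k)) (x div 2 ^ k) (z div 2 ^ k))"
    define N where "N = card (reps (2 ^ (l - k) + 1) (x div 2 ^ k) (z div 2 ^ k))"
    define P where "P = card (low_reps k y (x mod 2 ^ k) (z mod 2 ^ k))"
    define Q where "Q = card (low_reps k (y - 2 ^ k) (x mod 2 ^ k) (z mod 2 ^ k))"
    have "L (x mod 2 ^ k, z mod 2 ^ k) = min 2 (P + Q)" "S (x mod 2 ^ k, z mod 2 ^ k) = min 2 P"
      using c_ulam_block[OF assms(2,3), of "x mod 2 ^ k" "z mod 2 ^ k"]
      by (simp_all add: assms(5,6) B_iff P_def Q_def)
    moreover have "c_ulam (2 ^ l + y) (x, z) = min 2 (M * P + N * Q)"
    proof -
      have "2 ^ k * 2 ^ (l - k) = (2 :: nat) ^ l"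
        using assms(4) by (simp flip: power_add)
      then show ?thesis
        using card_reps_split[OF assms(2,3), of "2 ^ (l - k)" x z]
        by (simp add: c_ulam_eq_card_reps M_def N_def P_def Q_def)
    qed
    moreover have "P > 0 \<Longrightarrow> Q > 0"
      using low_reps_without_carry_nonempty[OF assms(2,3)]
      by (simp add: P_def Q_def low_reps_def card_gt_0_iff)
    \<comment> \<open>The number \<open>2 ^ (l - k)\<close> is even because
      \<open>l > k\<close>.\<close>
    moreover have "N > 0 \<Longrightarrow> M > 0"
      using reps_even_nonempty[of "2 ^ (l - k)"] assms(4)
      by (simp add: M_def N_def card_gt_0_iff)
    moreover have "c_ulam (2 ^ (l - k)) (x div 2 ^ k, z div 2 ^ k) = min 2 M"
      "c_ulam (2 ^ (l - k) + 1) (x div 2 ^ k, z div 2 ^ k) = min 2 N"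
      by (simp_all only: c_ulam_eq_card_reps M_def N_def)
    ultimately show ?thesis
      using truncated_surplus[of P Q N M]
      by (simp only: sat_mult_truncated sat_add_truncated)
  qed
  \<comment> \<open>The restricted left factors are thus evaluated only inside their domain, never
    at \<open>undefined\<close>.\<close>
  moreover have "(x div 2 ^ k, z div 2 ^ k) \<in> B (l - k + 1)" if "(x, z) \<in> B (l + 1)" for x z
    using that unfolding B_iff exps[symmetric] power_add
    by (auto intro: less_mult_imp_div_less)
  ultimately show "restrict (c_ulam (2 ^ l + y)) (B (l + 1)) =
      lab_add (l + 1)
        (lab_tensor (l - k + 1) k (restrict (c_ulam (2 ^ (l - k))) (B (l - k + 1))) S)
        (lab_tensor (l - k + 1) k (restrict (c_ulam (2 ^ (l - k) + 1)) (B (l - k + 1))) L)"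
    unfolding lab_add_def lab_tensor_def exps by (intro restrict_ext) auto
qed

end
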